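(* Let $t \le 1$ be a rational number. If $G$ is a minimally $t$-tough graph with a universal vertex, then $G \cong K_{1,\ell}$ and $t=1/\ell$ for some integer $\ell \ge 2$.
   Context: All graphs are finite, simple and undirected. $\omega(H)$ denotes the number of connected components of a graph $H$. For a real number $t$, a graph $G$ is $t$-tough if $|S| \ge t\cdot\omega(G-S)$ for every $S \subseteq V(G)$ with $\omega(G-S) > 1$. The toughness $\tau(G)$ is the largest $t$ for which $G$ is $t$-tough, where $\tau(K_n)=\infty$ for all $n\ge 1$. A graph $G$ is minimally $t$-tough if $\tau(G)=t$ and $\tau(G-e)<t$ for every $e\in E(G)$. A universal vertex is a vertex adjacent to all the other vertices. $K_{1,\ell}$ is the star with $\ell$ leaves. *)

theory Defs
  imports
    "HOL-Library.Extended_Real"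
    "Graph_Theory.Graph_Theory"
begin

text \<open>
  A finite simple undirected graph is a symmetric digraph in the sense of the locale
  \<^locale>\<open>graph\<close>: finite, without loops or parallel arcs. An undirected edge is a pair of
  opposite arcs, and the strongly connected components are the connected components.
\<close>

definition num_components :: "('a, 'b) pre_digraph \<Rightarrow> nat" where
  "num_components H = card (pre_digraph.sccs H)"

definition delete_verts :: "('a, 'b) pre_digraph \<Rightarrow> 'a set \<Rightarrow> ('a, 'b) pre_digraph" where
  "delete_verts G S = induce_subgraph G (verts G - S)"

text \<open>Deleting an undirected edge removes the given arc together with the opposite one.\<close>

definition delete_edge :: "('a, 'b) pre_digraph \<Rightarrow> 'b \<Rightarrow> ('a, 'b) pre_digraph" where
  "delete_edge G e =
     G\<lparr>arcs := {a \<in> arcs G. {tail G a, head G a} \<noteq> {tail G e, head G e}}\<rparr>"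

definition tough :: "real \<Rightarrow> ('a, 'b) pre_digraph \<Rightarrow> bool" where
  "tough t G \<longleftrightarrow>
     (\<forall>S \<subseteq> verts G. num_components (delete_verts G S) > 1 \<longrightarrow>
        real (card S) \<ge> t * real (num_components (delete_verts G S)))"

text \<open>
  In a graph that is not complete, two nonadjacent vertices are separated by deleting all
  the others, so the condition in \<^const>\<open>tough\<close> is not vacuous and, there being finitely
  many sets \<open>S\<close>, a greatest \<open>t\<close> exists. A complete graph is \<open>t\<close>-tough for every \<open>t\<close>.
\<close>

definition toughness :: "('a, 'b) pre_digraph \<Rightarrow> ereal" where
  "toughness G =
     (if complete_digraph (card (verts G)) G then \<infinity> else ereal (GREATEST t. tough t G))"

definition minimally_tough :: "real \<Rightarrow> ('a, 'b) pre_digraph \<Rightarrow> bool" where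
  "minimally_tough t G \<longleftrightarrow>
     toughness G = ereal t \<and> (\<forall>e \<in> arcs G. toughness (delete_edge G e) < ereal t)"

definition universal_vertex :: "('a, 'b) pre_digraph \<Rightarrow> 'a \<Rightarrow> bool" where
  "universal_vertex G u \<longleftrightarrow> u \<in> verts G \<and> (\<forall>v \<in> verts G. v \<noteq> u \<longrightarrow> u \<rightarrow>\<^bsub>G\<^esub> v)"

end

theory Submission
  imports Defs
begin

text \<open>
  Let \<open>u\<close> be universal and \<open>v\<close> another vertex. A set \<open>S\<close> witnessing that deleting \<open>uv\<close> lowers
  the toughness avoids \<open>u\<close> and \<open>v\<close>, and it leaves exactly two components, one of which is
  \<open>{v}\<close>: every vertex other than \<open>v\<close> is still joined to \<open>u\<close>. Hence the neighbours of \<open>v\<close>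
  lie in \<open>S \<union> {u}\<close>, and \<open>|S| < 2t\<close>. As \<open>t \<le> 1\<close>, the graph \<open>G - u\<close> has maximum degree at
  most one, so it is disconnected (\<open>G\<close> is not complete), and the cut \<open>{u}\<close> gives
  \<open>t \<le> 1/2\<close>. Now \<open>|S| < 2t\<close> forces \<open>S = {}\<close>, so \<open>G\<close> is a star with centre \<open>u\<close>.
\<close>

section \<open>Counting strong components\<close>

lemma (in wf_digraph) num_components_eq: "num_components G = card (scc_of ` verts G)"
  unfolding num_components_def card_sccs_verts[symmetric] sccs_verts_conv_scc_of ..

text \<open>Failure of reachability in one direction already puts \<open>a\<close> and
  \<open>b\<close> into different strong components.\<close>

lemma (in wf_digraph) num_components_gt_1I:
  assumes "finite (verts G)" "a \<in> verts G" "b \<in> verts G" "\<not> a \<rightarrow>\<^sup>* b"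
  shows "num_components G > 1"
proof -
  have "b \<in> scc_of b" "b \<notin> scc_of a" using assms by (auto simp: scc_of_def)
  then have "card {scc_of a, scc_of b} = 2" by (auto simp: card_insert_if)
  moreover have "card {scc_of a, scc_of b} \<le> card (scc_of ` verts G)"
    using assms by (intro card_mono) auto
  ultimately show ?thesis by (simp add: num_components_eq)
qed

text \<open>Every component is that of some representative in \<open>W\<close>. The upper bounds
  below take \<open>W\<close> to be the ends of the deleted edge, the universal vertex alone, or all
  surviving vertices.\<close>

lemma (in wf_digraph) num_components_le_card:
  assumes "finite W" "\<And>v. v \<in> verts G \<Longrightarrow> \<exists>w\<in>W. v \<rightarrow>\<^sup>* w \<and> w \<rightarrow>\<^sup>* v"
  shows "num_components G \<le> card W"
proof -
  have "scc_of ` verts G \<subseteq> scc_of ` W"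
  proof
    fix C assume "C \<in> scc_of ` verts G"
    then obtain v where v: "v \<in> verts G" "C = scc_of v" by auto
    then obtain w where "w \<in> W" "v \<rightarrow>\<^sup>* w" "w \<rightarrow>\<^sup>* v" using assms(2) by blast
    then have "v \<in> scc_of w" by (simp add: scc_of_def)
    then show "C \<in> scc_of ` W" using v \<open>w \<in> W\<close> scc_of_eq by blast
  qed
  then have "card (scc_of ` verts G) \<le> card (scc_of ` W)"
    using assms(1) by (intro card_mono) auto
  also have "\<dots> \<le> card W" using assms(1) by (rule card_image_le)
  finally show ?thesis by (simp add: num_components_eq)
qed

lemma (in wf_digraph) num_components_no_arcs:
  assumes "arcs_ends G = {}"
  shows "num_components G = card (verts G)"
proof -
  have "scc_of v = {v}" if "v \<in> verts G" for v
    using that assms by (auto simp: scc_of_def reachable_conv)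
  then have "inj_on scc_of (verts G)" by (auto intro!: inj_onI)
  then show ?thesis by (simp add: num_components_eq card_image)
qed

section \<open>Deleting vertices and edges\<close>

lemma verts_delete_verts [simp]: "verts (delete_verts G S) = verts G - S"
  by (simp add: delete_verts_def)

lemma verts_delete_edge [simp]: "verts (delete_edge G e) = verts G"
  by (simp add: delete_edge_def)

lemma arcs_ends_delete_verts:
  "arcs_ends (delete_verts G S) = arcs_ends G \<inter> (verts G - S) \<times> (verts G - S)"
  by (auto simp: delete_verts_def arcs_ends_conv)

lemma arcs_ends_delete_edge:
  "arcs_ends (delete_edge G e) = arcs_ends G - {(tail G e, head G e), (head G e, tail G e)}"
  by (auto simp: delete_edge_def arcs_ends_conv doubleton_eq_iff)

lemma (in wf_digraph) wf_digraph_delete_verts: "wf_digraph (delete_verts G S)"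
  by (simp add: delete_verts_def wellformed_induce_subgraph)

lemma (in wf_digraph) wf_digraph_delete_edge: "wf_digraph (delete_edge G e)"
  by unfold_locales (auto simp: delete_edge_def)

lemma symmetric_delete_verts: "symmetric G \<Longrightarrow> symmetric (delete_verts G S)"
  by (auto simp: symmetric_def arcs_ends_delete_verts sym_def)

lemma symmetric_delete_edge: "symmetric G \<Longrightarrow> symmetric (delete_edge G e)"
  by (auto simp: symmetric_def arcs_ends_delete_edge sym_def)

text \<open>The arcs of the deleted edge have an end in \<open>S\<close>, so deleting
  \<open>S\<close> removes them anyway.\<close>

lemma delete_verts_delete_edge:
  assumes "tail G e \<in> S \<or> head G e \<in> S"
  shows "delete_verts (delete_edge G e) S = delete_verts G S"
  using assms by (auto simp: delete_verts_def delete_edge_def induce_subgraph_def doubleton_eq_iff)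

section \<open>Toughness of a graph with a nonadjacent pair\<close>

lemma (in wf_digraph) tough_iff_le_toughness:
  assumes fin: "finite (verts G)"
    and ab: "a \<in> verts G" "b \<in> verts G" "a \<noteq> b" "\<not> a \<rightarrow> b"
  shows "tough t G \<longleftrightarrow> ereal t \<le> toughness G"
proof -
  \<comment> \<open>The toughness turns out to be the minimum \<open>m\<close> of the ratios
    \<open>f S\<close> over all disconnecting sets. It exists because \<open>A\<close> is finite
    and, thanks to the nonadjacent pair, nonempty.\<close>
  define A where "A = {S. S \<subseteq> verts G \<and> num_components (delete_verts G S) > 1}"
  define f where "f S = real (card S) / real (num_components (delete_verts G S))" for S
  define m where "m = Min (f ` A)"
  have "finite A" using fin by (simp add: A_def)
  have "verts G - {a, b} \<in> A"
  proof -
    let ?H = "delete_verts G (verts G - {a, b})"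
    interpret H: wf_digraph ?H by (rule wf_digraph_delete_verts)
    have "\<not> a \<rightarrow>\<^sup>*\<^bsub>?H\<^esub> b"
    proof
      assume "a \<rightarrow>\<^sup>*\<^bsub>?H\<^esub> b"
      \<comment> \<open>Only \<open>a\<close> and \<open>b\<close> survive and there is no arc from
        \<open>a\<close> to \<open>b\<close>, so a walk starting at \<open>a\<close> never leaves
        \<open>a\<close>.\<close>
      then have "b = a"
        by (induction rule: H.reachable_induct) (use ab in \<open>auto simp: arcs_ends_delete_verts\<close>)
      with ab show False by simp
    qed
    then have "num_components ?H > 1"
      using ab fin by (intro H.num_components_gt_1I[of a b]) auto
    then show ?thesis by (simp add: A_def)
  qed
  have tough_iff: "tough s G \<longleftrightarrow> s \<le> m" for s
  proof -
    have "tough s G \<longleftrightarrow> (\<forall>S\<in>A. s \<le> f S)"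
      by (auto simp: tough_def A_def f_def field_simps)
    also have "\<dots> \<longleftrightarrow> s \<le> m"
      using \<open>finite A\<close> \<open>_ \<in> A\<close> by (subst m_def, subst Min_ge_iff) auto
    finally show ?thesis .
  qed
  have "(GREATEST s. tough s G) = m" by (rule Greatest_equality) (simp_all add: tough_iff)
  moreover have "\<not> complete_digraph (card (verts G)) G"
    using ab by (auto simp: complete_digraph_def)
  ultimately show ?thesis by (simp add: toughness_def tough_iff)
qed

section \<open>Disconnecting sets and a universal vertex\<close>

lemma (in graph) neighbours_if_delete_edge_universal:
  assumes univ: "universal_vertex G u"
    and tough: "tough t G"
    and e: "e \<in> arcs G" "tail G e = u" "head G e = v"
    and less: "toughness (delete_edge G e) < ereal t"
  obtains S where "finite S" "real (card S) < 2 * t" "{w. v \<rightarrow> w} \<subseteq> insert u S"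
proof -
  let ?G = "delete_edge G e"
  have uv: "u \<in> verts G" "v \<in> verts G" "u \<noteq> v" using e no_loops by auto
  interpret E: wf_digraph ?G by (rule wf_digraph_delete_edge)
  have "(u, v) \<notin> arcs_ends ?G" using e by (simp add: arcs_ends_delete_edge)
  then have "\<not> tough t ?G"
    using uv less by (subst E.tough_iff_le_toughness[of u v]) auto
  then obtain S where S: "S \<subseteq> verts G" "num_components (delete_verts ?G S) > 1"
    "real (card S) < t * real (num_components (delete_verts ?G S))"
    by (auto simp: tough_def not_le)
  let ?H = "delete_verts ?G S"
  \<comment> \<open>If \<open>S\<close> contained an end of \<open>e\<close>, it would leave the
    same graph in \<open>G\<close> as in \<open>?G\<close> and so contradict the toughness of
    \<open>G\<close>.\<close>
  have "u \<notin> S" "v \<notin> S"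
    using S tough delete_verts_delete_edge[of G e S] e by (auto simp: tough_def not_le[symmetric])
  interpret H: wf_digraph ?H by (rule E.wf_digraph_delete_verts)
  have sym_H: "symmetric ?H"
    by (intro symmetric_delete_verts symmetric_delete_edge sym_arcs)
  \<comment> \<open>Among the arcs leaving \<open>u\<close>, only those to \<open>v\<close> were
    deleted, so \<open>u\<close> still reaches every other surviving vertex in one step.\<close>
  have adj: "w \<rightarrow>\<^sup>*\<^bsub>?H\<^esub> u \<and> u \<rightarrow>\<^sup>*\<^bsub>?H\<^esub> w" if "w \<in> verts G - S" "w \<noteq> v" for w
  proof (cases "w = u")
    case True
    then show ?thesis using that by auto
  next
    case False
    then have "(u, w) \<in> arcs_ends ?H"
      using univ that uv e \<open>u \<notin> S\<close>
      by (auto simp: universal_vertex_def arcs_ends_delete_verts arcs_ends_delete_edge)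
    then have "u \<rightarrow>\<^sup>*\<^bsub>?H\<^esub> w" by auto
    then show ?thesis using symmetric_reachable[OF sym_H] by blast
  qed
  have "num_components ?H \<le> card {u, v}"
  proof (rule H.num_components_le_card)
    fix w assume w: "w \<in> verts ?H"
    show "\<exists>z\<in>{u, v}. w \<rightarrow>\<^sup>*\<^bsub>?H\<^esub> z \<and> z \<rightarrow>\<^sup>*\<^bsub>?H\<^esub> w"
      by (cases "w = v") (use w adj H.reachable_refl in simp_all)
  qed simp
  also have "\<dots> = 2" using uv by simp
  finally have "num_components ?H = 2" using S by simp
  \<comment> \<open>Any further neighbour of \<open>v\<close> would link \<open>v\<close> to
    \<open>u\<close> in \<open>?H\<close> and leave a single component.\<close>
  have "{w. v \<rightarrow> w} \<subseteq> insert u S"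
  proof (rule ccontr)
    assume "\<not> ?thesis"
    then obtain w where w: "v \<rightarrow> w" "w \<noteq> u" "w \<notin> S" by auto
    then have "w \<in> verts G" "w \<noteq> v" using adj_in_verts adj_not_same by auto
    then have "(v, w) \<in> arcs_ends ?H"
      using w uv e \<open>v \<notin> S\<close> by (auto simp: arcs_ends_delete_verts arcs_ends_delete_edge)
    then have "v \<rightarrow>\<^sup>*\<^bsub>?H\<^esub> u"
      using adj[of w] w \<open>w \<in> verts G\<close> \<open>w \<noteq> v\<close> by (blast intro: H.adj_reachable_trans)
    then have "u \<rightarrow>\<^sup>*\<^bsub>?H\<^esub> v" by (rule symmetric_reachable[OF sym_H])
    have "num_components ?H \<le> card {u}"
    proof (rule H.num_components_le_card)
      fix w assume "w \<in> verts ?H"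
      then show "\<exists>z\<in>{u}. w \<rightarrow>\<^sup>*\<^bsub>?H\<^esub> z \<and> z \<rightarrow>\<^sup>*\<^bsub>?H\<^esub> w"
        using adj \<open>v \<rightarrow>\<^sup>*\<^bsub>?H\<^esub> u\<close> \<open>u \<rightarrow>\<^sup>*\<^bsub>?H\<^esub> v\<close> by (cases "w = v") simp_all
    qed simp
    then show False using S by simp
  qed
  moreover have "finite S" using S(1) finite_verts by (rule finite_subset)
  moreover have "real (card S) < 2 * t" using S \<open>num_components ?H = 2\<close> by simp
  ultimately show ?thesis using that by blast
qed

text \<open>A surviving \<open>u\<close> would keep the rest connected. Once \<open>u\<close> is
  deleted, each component uses up at least one of the remaining vertices.\<close>

lemma (in graph) num_components_delete_verts_le:
  assumes "universal_vertex G u" "S \<subseteq> verts G" "num_components (delete_verts G S) > 1"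
  shows "u \<in> S" "num_components (delete_verts G S) \<le> card (verts G - {u})"
proof -
  let ?H = "delete_verts G S"
  interpret H: wf_digraph ?H by (rule wf_digraph_delete_verts)
  have sym_H: "symmetric ?H" by (intro symmetric_delete_verts sym_arcs)
  show "u \<in> S"
  proof (rule ccontr)
    assume "u \<notin> S"
    have "u \<rightarrow>\<^sup>*\<^bsub>?H\<^esub> w" if "w \<in> verts G - S" for w
    proof (cases "w = u")
      case False
      then have "(u, w) \<in> arcs_ends ?H"
        using assms that \<open>u \<notin> S\<close> by (auto simp: universal_vertex_def arcs_ends_delete_verts)
      then show ?thesis by auto
    qed (use that in auto)
    then have "num_components ?H \<le> card {u}"
      using symmetric_reachable[OF sym_H] by (intro H.num_components_le_card) auto
    then show False using assms by simp
  qed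
  have "num_components ?H \<le> card (verts G - S)"
  proof (rule H.num_components_le_card)
    fix w assume "w \<in> verts ?H"
    then show "\<exists>z\<in>verts G - S. w \<rightarrow>\<^sup>*\<^bsub>?H\<^esub> z \<and> z \<rightarrow>\<^sup>*\<^bsub>?H\<^esub> w"
      using H.reachable_refl[of w] by (intro bexI[of _ w]) simp_all
  qed simp
  also have "\<dots> \<le> card (verts G - {u})"
    using \<open>u \<in> S\<close> by (intro card_mono) auto
  finally show "num_components ?H \<le> card (verts G - {u})" .
qed

section \<open>The star and its toughness\<close>

theorem theorem4p6:
  fixes G :: "('a, 'b) pre_digraph" and t :: real
  assumes "graph G"
    and "t \<in> \<rat>" and "t \<le> 1"
    and "minimally_tough t G"
    and "\<exists>u. universal_vertex G u"
  shows "\<exists>l::nat. l \<ge> 2 \<and> complete_bipartite_digraph 1 l G \<and> t = 1 / real l"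
proof -
  interpret graph G by fact
  obtain u where u: "universal_vertex G u" using assms by blast
  have "u \<in> verts G" using u by (simp add: universal_vertex_def)
  have toughness: "toughness G = ereal t"
    and minimal: "\<And>e. e \<in> arcs G \<Longrightarrow> toughness (delete_edge G e) < ereal t"
    using assms by (auto simp: minimally_tough_def)
  \<comment> \<open>Complete graphs have toughness \<infinity>, so the finite value \<open>t\<close>
    yields a nonadjacent pair, neither member of which is universal.\<close>
  have "\<not> complete_digraph (card (verts G)) G"
    using toughness by (auto simp: toughness_def)
  then have "arcs_ends G \<noteq> {(u, v). (u, v) \<in> verts G \<times> verts G \<and> u \<noteq> v}"
    using \<open>graph G\<close> by (simp add: complete_digraph_def)
  moreover have "arcs_ends G \<subseteq> {(u, v). (u, v) \<in> verts G \<times> verts G \<and> u \<noteq> v}"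
    using adj_in_verts adj_not_same by auto
  ultimately obtain a b where ab: "a \<in> verts G" "b \<in> verts G" "a \<noteq> b" "\<not> a \<rightarrow>\<^bsub>G\<^esub> b"
    by auto
  then have "\<not> b \<rightarrow>\<^bsub>G\<^esub> a" using graph_symmetric by blast
  then have "a \<noteq> u" "b \<noteq> u" using u ab by (auto simp: universal_vertex_def)
  have tough_iff: "tough s G \<longleftrightarrow> s \<le> t" for s
    using tough_iff_le_toughness[of a b s] ab toughness by simp

  have nbrs: "\<exists>S. finite S \<and> real (card S) < 2 * t \<and> {w. v \<rightarrow>\<^bsub>G\<^esub> w} \<subseteq> insert u S"
    if "v \<in> verts G" "v \<noteq> u" for v
  proof -
    have "u \<rightarrow>\<^bsub>G\<^esub> v" using u that by (auto simp: universal_vertex_def)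
    then obtain e where "e \<in> arcs G" "tail G e = u" "head G e = v" by auto
    then obtain S where "finite S" "real (card S) < 2 * t" "{w. v \<rightarrow>\<^bsub>G\<^esub> w} \<subseteq> insert u S"
      using neighbours_if_delete_edge_universal[OF u _ _ _ _ minimal] tough_iff by blast
    then show ?thesis by blast
  qed
  \<comment> \<open>Here \<open>t \<le> 1\<close> enters: \<open>card S\<close> is below 2, so
    \<open>v\<close> has at most one neighbour besides \<open>u\<close>.\<close>
  have le_one: "\<exists>s. {w. v \<rightarrow>\<^bsub>G\<^esub> w} \<subseteq> {u, s}" if v: "v \<in> verts G" "v \<noteq> u" for v
  proof -
    obtain S where S: "finite S" "real (card S) < 2 * t" "{w. v \<rightarrow>\<^bsub>G\<^esub> w} \<subseteq> insert u S"
      using nbrs[OF v] by blast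
    then have "card S = 0 \<or> card S = 1" using \<open>t \<le> 1\<close> by linarith
    then have "S = {} \<or> (\<exists>s. S = {s})" using S by (auto simp: card_1_singleton_iff)
    then show ?thesis using S by blast
  qed

  interpret U: wf_digraph "delete_verts G {u}" by (rule wf_digraph_delete_verts)
  have "\<not> a \<rightarrow>\<^sup>*\<^bsub>delete_verts G {u}\<^esub> b"
  proof
    assume "a \<rightarrow>\<^sup>*\<^bsub>delete_verts G {u}\<^esub> b"
    \<comment> \<open>Invariant of walks from \<open>a\<close> that avoid \<open>u\<close>: they
      stay on \<open>a\<close> and its neighbours, because a neighbour of \<open>a\<close> has no
      neighbour other than \<open>a\<close> and \<open>u\<close>.\<close>
    then have "b = a \<or> a \<rightarrow>\<^bsub>G\<^esub> b"
    proof (induction rule: U.reachable_induct)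
      case (step x y)
      then have xy: "x \<rightarrow>\<^bsub>G\<^esub> y" "x \<in> verts G" "x \<noteq> u" "y \<noteq> u"
        by (auto simp: arcs_ends_delete_verts)
      show ?case
      proof (cases "x = a")
        case False
        then have "x \<rightarrow>\<^bsub>G\<^esub> a" using step.IH graph_symmetric by blast
        then have "y = a" using le_one[OF xy(2,3)] xy \<open>a \<noteq> u\<close> by auto
        then show ?thesis ..
      qed (use xy in simp)
    qed simp
    then show False using ab by simp
  qed
  then have comps_ge_2: "num_components (delete_verts G {u}) \<ge> 2"
    using U.num_components_gt_1I[of a b] ab \<open>a \<noteq> u\<close> \<open>b \<noteq> u\<close> by simp
  have "\<forall>S\<subseteq>verts G. num_components (delete_verts G S) > 1 \<longrightarrow>
      t * real (num_components (delete_verts G S)) \<le> real (card S)"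
    using tough_iff[of t] by (simp add: tough_def)
  from this[rule_format, of "{u}"]
  have t_mult: "t * real (num_components (delete_verts G {u})) \<le> 1"
    using comps_ge_2 \<open>u \<in> verts G\<close> by simp
  have "2 * t \<le> 1"
  \<comment> \<open>Replacing the number of components by 2 needs a nonnegative factor; for negative
    \<open>t\<close> the bound is trivial.\<close>
  proof (cases "t \<ge> 0")
    case True
    then have "t * 2 \<le> t * real (num_components (delete_verts G {u}))"
      using comps_ge_2 by (intro mult_left_mono) auto
    then show ?thesis using t_mult by linarith
  qed simp

  define V where "V = verts G - {u}"
  \<comment> \<open>With \<open>2 * t \<le> 1\<close> the same sets \<open>S\<close> have fewer than
    one element, so \<open>u\<close> is the only possible neighbour.\<close>
  have only_u: "w = u" if "v \<in> V" "v \<rightarrow>\<^bsub>G\<^esub> w" for v w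
  proof -
    obtain S where S: "finite S" "real (card S) < 2 * t" "{w. v \<rightarrow>\<^bsub>G\<^esub> w} \<subseteq> insert u S"
      using nbrs[of v] \<open>v \<in> V\<close> by (auto simp: V_def)
    then have "card S = 0" using \<open>2 * t \<le> 1\<close> by linarith
    then show ?thesis using S that by auto
  qed
  have star: "arcs_ends G = {u} \<times> V \<union> V \<times> {u}"
  proof (intro equalityI subrelI)
    fix x y assume "x \<rightarrow>\<^bsub>G\<^esub> y"
    moreover have "x \<in> verts G" "y \<in> verts G" "x \<noteq> y"
      using \<open>x \<rightarrow>\<^bsub>G\<^esub> y\<close> adj_in_verts adj_not_same by auto
    ultimately show "(x, y) \<in> {u} \<times> V \<union> V \<times> {u}"
      using only_u[of x y] by (auto simp: V_def)
  next
    fix x y assume "(x, y) \<in> {u} \<times> V \<union> V \<times> {u}"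
    then show "x \<rightarrow>\<^bsub>G\<^esub> y"
      using u graph_symmetric by (auto simp: universal_vertex_def V_def)
  qed
  have "card {a, b} \<le> card V"
    using ab \<open>a \<noteq> u\<close> \<open>b \<noteq> u\<close> by (intro card_mono) (auto simp: V_def)
  then have "card V \<ge> 2" using ab by simp
  have "verts G = {u} \<union> V" "{u} \<inter> V = {}" "card {u} = 1"
    using \<open>u \<in> verts G\<close> by (auto simp: V_def)
  then have "complete_bipartite_digraph 1 (card V) G"
    unfolding complete_bipartite_digraph_def using \<open>graph G\<close> star by blast
  moreover have "t = 1 / real (card V)"
  \<comment> \<open>The cut \<open>{u}\<close> leaves \<open>card V\<close> isolated vertices, which
    bounds \<open>t\<close> from above. Conversely, a disconnecting set contains \<open>u\<close>,
    so it has at least one element, and it leaves at most \<open>card V\<close> components.\<close>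
  proof (rule antisym)
    have "arcs_ends (delete_verts G {u}) = {}"
      using star by (auto simp: arcs_ends_delete_verts)
    then have "num_components (delete_verts G {u}) = card V"
      using U.num_components_no_arcs by (simp add: V_def)
    then show "t \<le> 1 / real (card V)"
      using t_mult \<open>card V \<ge> 2\<close> by (simp add: field_simps)
    have "tough (1 / real (card V)) G"
      unfolding tough_def
    proof (intro allI impI)
      fix S assume S: "S \<subseteq> verts G" "num_components (delete_verts G S) > 1"
      note comps = num_components_delete_verts_le[OF u S]
      have "card S \<ge> 1"
        using comps(1) finite_subset[OF S(1) finite_verts] by (auto simp: Suc_le_eq card_gt_0_iff)
      moreover have "1 / real (card V) * real (num_components (delete_verts G S)) \<le> 1"
        using comps \<open>card V \<ge> 2\<close> by (simp add: V_def field_simps)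
      ultimately show "1 / real (card V) * real (num_components (delete_verts G S)) \<le> real (card S)"
        by linarith
    qed
    then show "1 / real (card V) \<le> t" by (simp add: tough_iff)
  qed
  ultimately show ?thesis using \<open>card V \<ge> 2\<close> by blast
qed

end
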